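(* For every positive integer $n$, with $i=\sqrt{-1}$, $$\sum_{\substack{0\le k\le n\\ 4\mid k}}\binom nk(-1)^{\frac k4}2^{-\frac k2}E_{n-k}(x)=\frac 12\Big\{\Big(x-\frac 12+\frac 12i\Big)^n+\Big(x-\frac 12-\frac 12i\Big)^n\Big\}.$$
   Context: The Euler polynomials $E_n(x)$ are defined by $\frac{2e^{xt}}{e^t+1}=\sum_{n\ge0}E_n(x)\frac{t^n}{n!}$ ($|t|<\pi$). *)

theory Defs
  imports "HOL-Complex_Analysis.Complex_Analysis"
begin

(* The generating function 2 e^(xt) / (e^t + 1), read as a formal power series in t.  The
   denominator has constant term 2, so the quotient is a genuine power series.  That the series
   converges to this function for |t| < pi is euler_poly_sums below; euler_poly_eqI says that
   this property determines the coefficients. *)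
definition euler_poly :: "nat \<Rightarrow> complex \<Rightarrow> complex" where
  "euler_poly n x = fact n * fps_nth (2 * fps_exp x / (fps_exp 1 + 1)) n"

lemma exp_plus_1_nonzero:
  fixes t :: complex
  assumes "norm t < pi"
  shows "exp t + 1 \<noteq> 0"
proof
  assume "exp t + 1 = 0"
  hence "exp t = exp (\<i> * pi)"
    by (simp add: add_eq_0_iff2)
  then obtain n :: int where n: "t = \<i> * pi + (of_int (2 * n) * pi) * \<i>"
    unfolding exp_eq by blast
  have "Im t = (2 * n + 1) * pi"
    by (simp add: n algebra_simps)
  moreover have "\<bar>Im t\<bar> < pi"
    using abs_Im_le_cmod[of t] assms by linarith
  ultimately have "\<bar>real_of_int (2 * n + 1)\<bar> < 1"
    by (simp add: abs_mult)
  hence "2 * n + 1 = 0"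
    by linarith
  thus False by presburger
qed

lemma euler_poly_sums:
  assumes "norm t < pi"
  shows "(\<lambda>n. euler_poly n x * t ^ n / fact n) sums (2 * exp (x * t) / (exp t + 1))"
proof -
  have "(\<lambda>t. 2 * exp (x * t) / (exp t + 1)) has_fps_expansion (2 * fps_exp x / (fps_exp 1 + 1))"
    by (intro fps_expansion_intros) auto
  moreover have "(\<lambda>t. 2 * exp (x * t) / (exp t + 1)) holomorphic_on eball 0 pi"
    using exp_plus_1_nonzero by (intro holomorphic_intros) auto
  ultimately have "(\<lambda>n. fps_nth (2 * fps_exp x / (fps_exp 1 + 1)) n * t ^ n) sums
                     (2 * exp (x * t) / (exp t + 1))"
    by (rule has_fps_expansion_imp_sums_complex) (use assms in auto)
  thus ?thesis
    by (simp add: euler_poly_def)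
qed

lemma euler_poly_eqI:
  assumes "\<And>t. norm t < pi \<Longrightarrow> (\<lambda>n. e n * t ^ n / fact n) sums (2 * exp (x * t) / (exp t + 1))"
  shows "e n = euler_poly n x"
proof -
  let ?f = "\<lambda>t. 2 * exp (x * t) / (exp t + 1)"
  have expansion: "?f has_fps_expansion Abs_fps (\<lambda>n. c n / fact n)"
    if "\<And>t. norm t < pi \<Longrightarrow> (\<lambda>n. c n * t ^ n / fact n) sums ?f t" for c
  proof (rule has_fps_expansionI)
    have "eventually (\<lambda>t::complex. t \<in> ball 0 pi) (nhds 0)"
      by (intro eventually_nhds_in_open) auto
    thus "eventually (\<lambda>t. (\<lambda>n. fps_nth (Abs_fps (\<lambda>n. c n / fact n)) n * t ^ n) sums ?f t) (nhds 0)"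
      by eventually_elim (use that in auto)
  qed
  have "Abs_fps (\<lambda>n. e n / fact n) = Abs_fps (\<lambda>n. euler_poly n x / fact n)"
    by (rule fps_expansion_unique_complex[of ?f]; rule expansion)
       (use assms euler_poly_sums in auto)
  thus ?thesis
    by (simp add: fps_eq_iff)
qed

end

theory Submission
  imports Defs
begin

text \<open>The weights are the Taylor coefficients of
  \<open>cosh (t/2) * cos (t/2) = (1/4) * (\<Sum>w. exp (w * t))\<close>, with \<open>w\<close> ranging over the four roots of
  \<open>w ^ 4 = - 1/4\<close>. This series is divisible by \<open>exp t + 1\<close>, so in its product with
  \<open>2 * exp (x * t) / (exp t + 1)\<close> the denominator cancels.\<close>

text \<open>With \<open>k = 4 * q + r\<close>, each root satisfies
  \<open>w ^ k = (-1/4) ^ q * w ^ r\<close>. This leaves the power sums of the four roots for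
  \<open>r < 4\<close>, which are 4 for \<open>r = 0\<close> and vanish for
  \<open>r = 1, 2, 3\<close>.\<close>

lemma sum_powers_fourth_roots:
  "((1 + \<i>) / 2) ^ k + ((1 - \<i>) / 2) ^ k + ((-1 + \<i>) / 2) ^ k + ((-1 - \<i>) / 2) ^ k =
     (if 4 dvd k then 4 * (-1/4) ^ (k div 4) else 0)"
proof -
  define q r where "q = k div 4" and "r = k mod 4"
  have k: "k = 4 * q + r" and "r < 4"
    by (simp_all add: q_def r_def)
  hence r: "r \<in> {0, 1, 2, 3}"
    by auto
  have fourth: "((1 + \<i>) / 2) ^ 4 = -1/4" "((1 - \<i>) / 2) ^ 4 = -1/4"
    "((-1 + \<i>) / 2) ^ 4 = -1/4" "((-1 - \<i>) / 2) ^ 4 = -1/4"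
    by (simp_all add: power4_eq_xxxx field_simps complex_eq_iff)
  have "((1 + \<i>) / 2) ^ r + ((1 - \<i>) / 2) ^ r + ((-1 + \<i>) / 2) ^ r + ((-1 - \<i>) / 2) ^ r =
      (if r = 0 then 4 else 0)"
    using r by (auto simp: power2_eq_square power3_eq_cube complex_eq_iff field_simps)
  moreover have "w ^ k = (-1/4) ^ q * w ^ r" if "w ^ 4 = -1/4" for w :: complex
    by (simp add: k power_add power_mult that)
  ultimately have "((1 + \<i>) / 2) ^ k + ((1 - \<i>) / 2) ^ k + ((-1 + \<i>) / 2) ^ k + ((-1 - \<i>) / 2) ^ k =
      (-1/4) ^ q * (if r = 0 then 4 else 0)"
    using fourth by (simp flip: distrib_left)
  thus ?thesis
    by (simp add: q_def r_def dvd_eq_mod_eq_0)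
qed

lemma two_powr_minus_half:
  assumes "4 dvd k"
  shows "2 powr (- real k / 2) = (1/4) ^ (k div 4)"
proof -
  obtain q where k: "k = 4 * q"
    using assms by blast
  have "2 powr (- real k / 2) = (2 powr (-2)) powr real q"
    by (simp add: k powr_powr)
  also have "\<dots> = (1/4) ^ q"
    by (simp add: powr_realpow powr_minus)
  finally show ?thesis
    by (simp add: k)
qed

definition cosh_cos_half_fps :: "complex fps" where
  "cosh_cos_half_fps = fps_const (1/4) *
     (fps_exp ((1 + \<i>) / 2) + fps_exp ((1 - \<i>) / 2) +
      fps_exp ((-1 + \<i>) / 2) + fps_exp ((-1 - \<i>) / 2))"

text \<open>Each \<open>fps_exp w\<close> contributes \<open>w ^ k / fact k\<close>, so the power
  sums of the four roots decide the coefficient: up to \<open>fact k\<close> it is the weight in the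
  theorem.\<close>

lemma fps_nth_cosh_cos_half:
  "fps_nth cosh_cos_half_fps k =
     (if 4 dvd k then (-1) ^ (k div 4) * of_real (2 powr (- real k / 2)) / fact k else 0)"
proof -
  have "fps_nth cosh_cos_half_fps k =
      (((1 + \<i>) / 2) ^ k + ((1 - \<i>) / 2) ^ k + ((-1 + \<i>) / 2) ^ k + ((-1 - \<i>) / 2) ^ k) / (4 * fact k)"
    by (simp add: cosh_cos_half_fps_def add_divide_distrib mult.commute)
  also have "\<dots> = (if 4 dvd k then (-1/4) ^ (k div 4) / fact k else 0)"
    unfolding sum_powers_fourth_roots by simp
  finally show ?thesis
    \<comment> \<open>For \<open>k = 4 * q\<close> the factor \<open>(-1/4) ^ q\<close> splits into
      the sign \<open>(-1) ^ q\<close> and \<open>(1/4) ^ q\<close>, the value of the real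
      power.\<close>
    by (simp add: two_powr_minus_half [simplified] power_minus [of "1/4"])
qed

lemma cosh_cos_half_times_euler_fps:
  "cosh_cos_half_fps * (2 * fps_exp x / (fps_exp 1 + 1)) =
     fps_const (1/2) * (fps_exp (x - 1/2 + 1/2 * \<i>) + fps_exp (x - 1/2 - 1/2 * \<i>))"
proof -
  define D :: "complex fps" where "D = fps_exp 1 + 1"
  define B :: "complex fps" where "B = fps_exp ((-1 + \<i>) / 2) + fps_exp ((-1 - \<i>) / 2)"
  \<comment> \<open>The constant term is 2, so \<open>D\<close> is a unit and dividing by it can be
    undone by multiplication.\<close>
  have "fps_nth D 0 \<noteq> 0"
    by (simp add: D_def)
  hence "2 * fps_exp x / D * D = 2 * fps_exp x"
    by (simp add: fps_divide_unit mult.assoc inverse_mult_eq_1)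
  \<comment> \<open>Adding 1 to the two exponents in \<open>B\<close> gives the other two roots, so
    the four exponentials group as \<open>fps_exp 1 * B + B\<close>.\<close>
  moreover have "cosh_cos_half_fps = fps_const (1/4) * (D * B)"
    by (simp add: cosh_cos_half_fps_def D_def B_def distrib_left distrib_right
        fps_exp_add_mult [symmetric] field_simps)
  ultimately have "cosh_cos_half_fps * (2 * fps_exp x / D) = fps_const (1/4) * (2 * fps_exp x * B)"
    by (metis (no_types, lifting) mult.assoc mult.commute)
  also have "\<dots> = fps_const (1/4) * 2 * (fps_exp x * B)"
    by (simp only: mult.assoc)
  also have "fps_const (1/4) * 2 = (fps_const (1/2) :: complex fps)"
    by (simp add: numeral_fps_const)
  also have "fps_exp x * B = fps_exp (x - 1/2 + 1/2 * \<i>) + fps_exp (x - 1/2 - 1/2 * \<i>)"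
    by (simp add: B_def distrib_left fps_exp_add_mult [symmetric] diff_divide_distrib
        add_divide_distrib algebra_simps)
  finally show ?thesis
    unfolding D_def .
qed

theorem theorem3p1:
  fixes n :: nat and x :: complex
  assumes "n > 0"
  shows "(\<Sum>k | k \<le> n \<and> 4 dvd k.
            of_nat (n choose k) * (-1) ^ (k div 4) * of_real (2 powr (- real k / 2)) *
            euler_poly (n - k) x) =
         1 / 2 * ((x - 1 / 2 + 1 / 2 * \<i>) ^ n + (x - 1 / 2 - 1 / 2 * \<i>) ^ n)"
proof -
  let ?E = "2 * fps_exp x / (fps_exp 1 + 1)"
  let ?w = "\<lambda>k. (-1) ^ (k div 4) * of_real (2 powr (- real k / 2)) :: complex"
  have "(\<Sum>k | k \<le> n \<and> 4 dvd k. of_nat (n choose k) * ?w k * euler_poly (n - k) x) =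
      (\<Sum>k\<in>{0..n}. fact n * (fps_nth cosh_cos_half_fps k * fps_nth ?E (n - k)))"
  \<comment> \<open>The indices not divisible by 4 may be added because their coefficients are zero;
    for the others the factorials in the binomial coefficient are shared out between the two series.
    The result is a Cauchy product.\<close>
  proof (rule sum.mono_neutral_cong_left)
    fix k assume "k \<in> {k. k \<le> n \<and> 4 dvd k}"
    thus "of_nat (n choose k) * ?w k * euler_poly (n - k) x =
        fact n * (fps_nth cosh_cos_half_fps k * fps_nth ?E (n - k))"
      by (simp add: fps_nth_cosh_cos_half euler_poly_def binomial_fact)
  qed (auto simp: fps_nth_cosh_cos_half)
  also have "\<dots> = fact n * fps_nth (cosh_cos_half_fps * ?E) n"
    by (simp add: fps_mult_nth sum_distrib_left)
  also have "\<dots> = 1 / 2 * ((x - 1 / 2 + 1 / 2 * \<i>) ^ n + (x - 1 / 2 - 1 / 2 * \<i>) ^ n)"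
    \<comment> \<open>The coefficients \<open>c ^ n / fact n\<close> of the two remaining
      exponentials absorb the factor \<open>fact n\<close>.\<close>
    unfolding cosh_cos_half_times_euler_fps by (simp add: field_simps)
  finally show ?thesis
    by (simp add: mult.assoc)
qed

end
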